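(* Let $S$ be the unilateral shift on $H^2$. Then for any bounded linear operator $X$ on $H^2$: (1) $SX=XS^*$ if and only if $X=0$; (2) $SX=X^*S^*$ if and only if $X=AS^*$ for some self-adjoint operator $A\in\mathcal{B}(H^2)$.
   Context: $H^2$ is the (scalar) Hardy–Hilbert space of holomorphic functions $f(z)=\sum_{n\ge0}a_nz^n$ on the unit disk with $\sum|a_n|^2<\infty$, and the unilateral shift $S$ is $(Sf)(z)=zf(z)$. $\mathcal{B}(H^2)$ is the algebra of bounded linear operators on $H^2$. *)

theory Defs
  imports "HOL-Complex_Analysis.Complex_Analysis"
begin

text \<open>
  \<^term>\<open>fps_expansion f 0\<close> is the Taylor series of \<^term>\<open>f\<close> at \<^term>\<open>0::complex\<close>. Functions on the
  disk are represented by total functions that vanish off the open unit disk, so that equality of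
  elements of the type is equality of functions on the disk.
\<close>

typedef hardy =
  "{f :: complex \<Rightarrow> complex. f holomorphic_on ball 0 1 \<and> (\<forall>z. z \<notin> ball 0 1 \<longrightarrow> f z = 0) \<and>
      summable (\<lambda>n. (cmod (fps_nth (fps_expansion f 0) n))\<^sup>2)}"
  morphisms hardy_fun Abs_hardy
proof
  have "fps_expansion (\<lambda>z::complex. 0) 0 = 0"
    by (rule fps_expansion_eqI) simp
  then show "(\<lambda>z. 0) \<in> {f :: complex \<Rightarrow> complex. f holomorphic_on ball 0 1 \<and>
      (\<forall>z. z \<notin> ball 0 1 \<longrightarrow> f z = 0) \<and> summable (\<lambda>n. (cmod (fps_nth (fps_expansion f 0) n))\<^sup>2)}"
    by simp
qed

setup_lifting type_definition_hardy

lemma has_fps_expansion_disk: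
  "f holomorphic_on ball 0 1 \<Longrightarrow> f has_fps_expansion fps_expansion f 0"
  by (rule has_fps_expansion_fps_expansion[of "ball 0 1"]) auto

lemma fps_expansion_zero_fun: "fps_expansion (\<lambda>z::complex. 0) 0 = 0"
  by (rule fps_expansion_eqI) simp

lemma fps_expansion_add_disk:
  "f holomorphic_on ball 0 1 \<Longrightarrow> g holomorphic_on ball 0 1 \<Longrightarrow>
     fps_expansion (\<lambda>z. f z + g z) 0 = fps_expansion f 0 + fps_expansion g 0"
  by (intro fps_expansion_eqI has_fps_expansion_add has_fps_expansion_disk)

lemma fps_expansion_cmult_disk:
  "f holomorphic_on ball 0 1 \<Longrightarrow>
     fps_expansion (\<lambda>z. c * f z) 0 = fps_const c * fps_expansion f 0"
  by (intro fps_expansion_eqI has_fps_expansion_cmult_left has_fps_expansion_disk)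

lemma fps_expansion_shift_disk:
  "f holomorphic_on ball 0 1 \<Longrightarrow>
     fps_expansion (\<lambda>z. z * f z) 0 = fps_X * fps_expansion f 0"
  by (intro fps_expansion_eqI has_fps_expansion_mult has_fps_expansion_disk
      has_fps_expansion_fps_X)

lemma summable_norm_square_add:
  fixes a b :: "nat \<Rightarrow> complex"
  assumes "summable (\<lambda>n. (cmod (a n))\<^sup>2)" "summable (\<lambda>n. (cmod (b n))\<^sup>2)"
  shows "summable (\<lambda>n. (cmod (a n + b n))\<^sup>2)"
proof (rule summable_comparison_test'[where N = 0])
  show "summable (\<lambda>n. 2 * (cmod (a n))\<^sup>2 + 2 * (cmod (b n))\<^sup>2)"
    by (intro summable_add summable_mult assms)
  fix n :: nat
  have "(cmod (a n + b n))\<^sup>2 \<le> (cmod (a n) + cmod (b n))\<^sup>2"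
    by (intro power_mono norm_triangle_ineq) auto
  also have "\<dots> \<le> 2 * (cmod (a n))\<^sup>2 + 2 * (cmod (b n))\<^sup>2"
    using sum_squares_bound[of "cmod (a n)" "cmod (b n)"] by (simp add: power2_sum)
  finally show "norm ((cmod (a n + b n))\<^sup>2) \<le> 2 * (cmod (a n))\<^sup>2 + 2 * (cmod (b n))\<^sup>2"
    by simp
qed

lemma summable_mult_cnj:
  fixes a b :: "nat \<Rightarrow> complex"
  assumes "summable (\<lambda>n. (cmod (a n))\<^sup>2)" "summable (\<lambda>n. (cmod (b n))\<^sup>2)"
  shows "summable (\<lambda>n. a n * cnj (b n))"
proof (rule summable_comparison_test'[where N = 0])
  show "summable (\<lambda>n. (cmod (a n))\<^sup>2 + (cmod (b n))\<^sup>2)"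
    by (intro summable_add assms)
  fix n :: nat
  have "2 * (cmod (a n) * cmod (b n)) \<le> (cmod (a n))\<^sup>2 + (cmod (b n))\<^sup>2"
    using sum_squares_bound[of "cmod (a n)" "cmod (b n)"] by simp
  moreover have "0 \<le> cmod (a n) * cmod (b n)"
    by simp
  ultimately show "norm (a n * cnj (b n)) \<le> (cmod (a n))\<^sup>2 + (cmod (b n))\<^sup>2"
    by (simp only: norm_mult complex_mod_cnj)
qed

lift_definition hardy_scaleC :: "complex \<Rightarrow> hardy \<Rightarrow> hardy" is "\<lambda>c f z. c * f z"
proof -
  fix c :: complex and f :: "complex \<Rightarrow> complex"
  assume f: "f holomorphic_on ball 0 1 \<and> (\<forall>z. z \<notin> ball 0 1 \<longrightarrow> f z = 0) \<and>
      summable (\<lambda>n. (cmod (fps_nth (fps_expansion f 0) n))\<^sup>2)"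
  then have "summable (\<lambda>n. (cmod c)\<^sup>2 * (cmod (fps_nth (fps_expansion f 0) n))\<^sup>2)"
    by (intro summable_mult) simp
  with f show "(\<lambda>z. c * f z) holomorphic_on ball 0 1 \<and> (\<forall>z. z \<notin> ball 0 1 \<longrightarrow> c * f z = 0) \<and>
      summable (\<lambda>n. (cmod (fps_nth (fps_expansion (\<lambda>z. c * f z) 0) n))\<^sup>2)"
    by (simp add: fps_expansion_cmult_disk norm_mult power_mult_distrib holomorphic_on_mult)
qed

instantiation hardy :: ab_group_add
begin

lift_definition zero_hardy :: hardy is "\<lambda>z. 0"
  by (simp add: fps_expansion_zero_fun)

lift_definition plus_hardy :: "hardy \<Rightarrow> hardy \<Rightarrow> hardy" is "\<lambda>f g z. f z + g z"
  by (auto simp: fps_expansion_add_disk summable_norm_square_add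
      intro: holomorphic_on_add)

definition uminus_hardy :: "hardy \<Rightarrow> hardy" where
  "uminus_hardy f = hardy_scaleC (-1) f"

definition minus_hardy :: "hardy \<Rightarrow> hardy \<Rightarrow> hardy" where
  "minus_hardy f g = f + (- g)"

instance
proof
  fix a b c :: hardy
  show "a + b + c = a + (b + c)" by transfer (simp add: add.assoc)
  show "a + b = b + a" by transfer (simp add: add.commute)
  show "0 + a = a" by transfer simp
  show "- a + a = 0" unfolding uminus_hardy_def by transfer simp
  show "a - b = a + - b" by (simp add: minus_hardy_def)
qed

end

definition hardy_coeff :: "hardy \<Rightarrow> nat \<Rightarrow> complex" where
  "hardy_coeff f n = fps_nth (fps_expansion (hardy_fun f) 0) n"

definition hardy_cinner :: "hardy \<Rightarrow> hardy \<Rightarrow> complex" where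
  "hardy_cinner f g = (\<Sum>n. hardy_coeff f n * cnj (hardy_coeff g n))"

lemma summable_hardy_coeff: "summable (\<lambda>n. (cmod (hardy_coeff f n))\<^sup>2)"
  unfolding hardy_coeff_def using hardy_fun[of f] by simp

lemma summable_hardy_cinner: "summable (\<lambda>n. hardy_coeff f n * cnj (hardy_coeff g n))"
  by (intro summable_mult_cnj summable_hardy_coeff)

lemma hardy_coeff_add: "hardy_coeff (f + g) n = hardy_coeff f n + hardy_coeff g n"
  unfolding hardy_coeff_def by transfer (simp add: fps_expansion_add_disk)

lemma hardy_coeff_scaleC: "hardy_coeff (hardy_scaleC c f) n = c * hardy_coeff f n"
  unfolding hardy_coeff_def by transfer (simp add: fps_expansion_cmult_disk)

lemma hardy_coeff_zero: "hardy_coeff 0 n = 0"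
  unfolding hardy_coeff_def by transfer (simp add: fps_expansion_zero_fun)

lemma hardy_eq_zeroI:
  assumes "\<And>n. hardy_coeff f n = 0"
  shows "f = 0"
  using assms unfolding hardy_coeff_def
proof transfer
  fix f :: "complex \<Rightarrow> complex"
  assume f: "f holomorphic_on ball 0 1 \<and> (\<forall>z. z \<notin> ball 0 1 \<longrightarrow> f z = 0) \<and>
      summable (\<lambda>n. (cmod (fps_nth (fps_expansion f 0) n))\<^sup>2)"
    and coeff: "\<And>n. fps_nth (fps_expansion f 0) n = 0"
  have "f z = 0" if "z \<in> ball 0 1" for z
    using holomorphic_fun_eq_0_on_ball[of f 0 1 z] f that coeff
    by (simp add: fps_expansion_def)
  then show "f = (\<lambda>z. 0)"
    using f by auto
qed

lemma hardy_cinner_add_left: "hardy_cinner (f + g) h = hardy_cinner f h + hardy_cinner g h"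
  unfolding hardy_cinner_def
  by (simp add: hardy_coeff_add distrib_right suminf_add summable_hardy_cinner)

lemma hardy_cinner_scaleC_left: "hardy_cinner (hardy_scaleC c f) g = c * hardy_cinner f g"
  unfolding hardy_cinner_def
  by (simp add: hardy_coeff_scaleC mult.assoc suminf_mult summable_hardy_cinner)

lemma hardy_cinner_commute: "hardy_cinner f g = cnj (hardy_cinner g f)"
  unfolding hardy_cinner_def
  using sums_cnj[of "\<lambda>n. hardy_coeff g n * cnj (hardy_coeff f n)"]
  by (simp add: sums_iff summable_hardy_cinner mult.commute)

lemma hardy_cinner_self:
  "hardy_cinner f f = complex_of_real (\<Sum>n. (cmod (hardy_coeff f n))\<^sup>2)"
  unfolding hardy_cinner_def complex_norm_square[symmetric]
  using summable_hardy_coeff[of f] by (simp add: suminf_of_real)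

instantiation hardy :: real_vector
begin

definition scaleR_hardy :: "real \<Rightarrow> hardy \<Rightarrow> hardy" where
  "scaleR_hardy r f = hardy_scaleC (complex_of_real r) f"

instance
proof
  fix f g :: hardy and r s :: real
  show "r *\<^sub>R (f + g) = r *\<^sub>R f + r *\<^sub>R g"
    unfolding scaleR_hardy_def by transfer (simp add: algebra_simps)
  show "(r + s) *\<^sub>R f = r *\<^sub>R f + s *\<^sub>R f"
    unfolding scaleR_hardy_def by transfer (simp add: algebra_simps)
  show "r *\<^sub>R s *\<^sub>R f = (r * s) *\<^sub>R f"
    unfolding scaleR_hardy_def by transfer (simp add: algebra_simps)
  show "1 *\<^sub>R f = f"
    unfolding scaleR_hardy_def by transfer simp
qed

end

text \<open>
  The real inner product of the library class is the real part of the complex one; since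
  \<^term>\<open>hardy_cinner f f\<close> is real, both induce the norm of the Hardy space.
\<close>

instantiation hardy :: real_inner
begin

definition inner_hardy :: "hardy \<Rightarrow> hardy \<Rightarrow> real" where
  "inner_hardy f g = Re (hardy_cinner f g)"

definition norm_hardy :: "hardy \<Rightarrow> real" where
  "norm_hardy f = sqrt (inner f f)"

definition sgn_hardy :: "hardy \<Rightarrow> hardy" where
  "sgn_hardy f = f /\<^sub>R norm f"

definition dist_hardy :: "hardy \<Rightarrow> hardy \<Rightarrow> real" where
  "dist_hardy f g = norm (f - g)"

definition uniformity_hardy :: "(hardy \<times> hardy) filter" where
  "uniformity_hardy = (INF e\<in>{0<..}. principal {(x, y). dist x y < e})"

definition open_hardy :: "hardy set \<Rightarrow> bool" where
  "open_hardy U \<longleftrightarrow> (\<forall>x\<in>U. \<forall>\<^sub>F (x', y) in uniformity. x' = x \<longrightarrow> y \<in> U)"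

instance
proof
  fix f g h :: hardy and r :: real
  show "inner f g = inner g f"
    unfolding inner_hardy_def using hardy_cinner_commute[of f g] by simp
  show "inner (f + g) h = inner f h + inner g h"
    by (simp add: inner_hardy_def hardy_cinner_add_left)
  show "inner (r *\<^sub>R f) g = r * inner f g"
    by (simp add: inner_hardy_def scaleR_hardy_def hardy_cinner_scaleC_left)
  show "0 \<le> inner f f"
    by (simp add: inner_hardy_def hardy_cinner_self suminf_nonneg summable_hardy_coeff)
  show "inner f f = 0 \<longleftrightarrow> f = 0"
  proof
    assume "inner f f = 0"
    then have "\<forall>n. (cmod (hardy_coeff f n))\<^sup>2 = 0"
      by (simp add: inner_hardy_def hardy_cinner_self suminf_eq_zero_iff summable_hardy_coeff)
    then show "f = 0"
      by (intro hardy_eq_zeroI) simp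
  qed (simp add: inner_hardy_def hardy_cinner_self hardy_coeff_zero)
qed (auto simp: norm_hardy_def sgn_hardy_def dist_hardy_def uniformity_hardy_def open_hardy_def)

end

text \<open>
  Bounded operators are values of the library type of bounded real-linear maps; the condition below
  restricts them to the complex-linear ones.
\<close>

definition hardy_operators :: "(hardy \<Rightarrow>\<^sub>L hardy) set" where
  "hardy_operators =
     {X. \<forall>c f. blinfun_apply X (hardy_scaleC c f) = hardy_scaleC c (blinfun_apply X f)}"

text \<open>
  For \<^term>\<open>X \<in> hardy_operators\<close> the operator below exists by the Riesz representation theorem, and is
  unique; for other \<^term>\<open>X\<close> it is unspecified.
\<close>

definition hardy_adjoint :: "(hardy \<Rightarrow>\<^sub>L hardy) \<Rightarrow> (hardy \<Rightarrow>\<^sub>L hardy)" where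
  "hardy_adjoint X = (THE Y. Y \<in> hardy_operators \<and>
     (\<forall>f g. hardy_cinner (blinfun_apply X f) g = hardy_cinner f (blinfun_apply Y g)))"

definition hardy_selfadjoint :: "(hardy \<Rightarrow>\<^sub>L hardy) \<Rightarrow> bool" where
  "hardy_selfadjoint A \<longleftrightarrow> hardy_adjoint A = A"

lift_definition hardy_mult_z :: "hardy \<Rightarrow> hardy" is "\<lambda>f z. z * f z"
proof -
  fix f :: "complex \<Rightarrow> complex"
  assume f: "f holomorphic_on ball 0 1 \<and> (\<forall>z. z \<notin> ball 0 1 \<longrightarrow> f z = 0) \<and>
      summable (\<lambda>n. (cmod (fps_nth (fps_expansion f 0) n))\<^sup>2)"
  then have "summable (\<lambda>n. (cmod (fps_nth (fps_X * fps_expansion f 0) (Suc n)))\<^sup>2)"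
    by simp
  then have "summable (\<lambda>n. (cmod (fps_nth (fps_X * fps_expansion f 0) n))\<^sup>2)"
    by (rule iffD1[OF summable_Suc_iff])
  with f show "(\<lambda>z. z * f z) holomorphic_on ball 0 1 \<and> (\<forall>z. z \<notin> ball 0 1 \<longrightarrow> z * f z = 0) \<and>
      summable (\<lambda>n. (cmod (fps_nth (fps_expansion (\<lambda>z. z * f z) 0) n))\<^sup>2)"
    by (auto simp: fps_expansion_shift_disk intro!: holomorphic_intros)
qed

lemma hardy_coeff_mult_z:
  "hardy_coeff (hardy_mult_z f) n = (if n = 0 then 0 else hardy_coeff f (n - 1))"
  unfolding hardy_coeff_def by transfer (simp add: fps_expansion_shift_disk)

lemma norm_hardy_mult_z: "norm (hardy_mult_z f) = norm f"
proof -
  have "(\<Sum>n. (cmod (hardy_coeff (hardy_mult_z f) n))\<^sup>2) = (\<Sum>n. (cmod (hardy_coeff f n))\<^sup>2)"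
    using suminf_split_head[OF summable_hardy_coeff[of "hardy_mult_z f"]]
    by (simp add: hardy_coeff_mult_z)
  then show ?thesis
    by (simp add: norm_hardy_def inner_hardy_def hardy_cinner_self)
qed

lift_definition hardy_shift :: "hardy \<Rightarrow>\<^sub>L hardy" is hardy_mult_z
proof (rule bounded_linear_intro[where K = 1])
  fix f g :: hardy and r :: real
  show "hardy_mult_z (f + g) = hardy_mult_z f + hardy_mult_z g"
    by transfer (simp add: algebra_simps)
  show "hardy_mult_z (r *\<^sub>R f) = r *\<^sub>R hardy_mult_z f"
    unfolding scaleR_hardy_def by transfer (simp add: algebra_simps)
qed (simp add: norm_hardy_mult_z)

end

theory Submission
  imports Defs
begin

text \<open>
  Since \<open>S\<^sup>*S = I\<close> and \<open>I - SS\<^sup>*\<close> is the projection onto the constants, \<open>SX = X\<^sup>*S\<^sup>*\<close> gives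
  \<open>SX1 = 0\<close>, hence \<open>X1 = 0\<close> and \<open>X = (XS)S\<^sup>*\<close>, while \<open>XS = S\<^sup>*(SX)S = S\<^sup>*X\<^sup>*S\<^sup>*S = (XS)\<^sup>*\<close>.
  If \<open>SX = XS\<^sup>*\<close>, then \<open>X\<close> kills the monomials one after the other, because
  \<open>SXz\<^sup>n\<^sup>+\<^sup>1 = Xz\<^sup>n\<close> and \<open>S\<close> is injective. Adjoints are built from matrix coefficients, so that neither
  completeness of the space nor the Riesz representation theorem is needed.
\<close>

section \<open>Coefficients and the inner product\<close>

lemma hardy_coeff_minus: "hardy_coeff (f - g) n = hardy_coeff f n - hardy_coeff g n"
  by (simp add: minus_hardy_def uminus_hardy_def hardy_coeff_add hardy_coeff_scaleC)

lemma hardy_eqI: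
  assumes "\<And>n. hardy_coeff f n = hardy_coeff g n"
  shows "f = g"
proof -
  have "f - g = 0"
    by (rule hardy_eq_zeroI) (simp add: hardy_coeff_minus assms)
  then show ?thesis by simp
qed

lemma hardy_scaleC_zero: "hardy_scaleC c 0 = 0"
  by (rule hardy_eqI) (simp add: hardy_coeff_scaleC hardy_coeff_zero)

lemma hardy_coeff_sum: "hardy_coeff (sum f A) n = (\<Sum>i\<in>A. hardy_coeff (f i) n)"
  by (induction A rule: infinite_finite_induct) (simp_all add: hardy_coeff_zero hardy_coeff_add)

lemma hardy_cinner_zero_left: "hardy_cinner 0 g = 0"
  by (simp add: hardy_cinner_def hardy_coeff_zero)

lemma hardy_cinner_sum_left: "hardy_cinner (sum f A) g = (\<Sum>i\<in>A. hardy_cinner (f i) g)"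
  by (induction A rule: infinite_finite_induct)
    (simp_all add: hardy_cinner_zero_left hardy_cinner_add_left)

lemma norm_hardy_square: "(norm f)\<^sup>2 = (\<Sum>n. (cmod (hardy_coeff f n))\<^sup>2)"
  by (simp add: power2_norm_eq_inner inner_hardy_def hardy_cinner_self)

text \<open>Square-summable coefficients are bounded, so comparison with a geometric series gives
  radius of convergence at least 1. With \<open>hardy_eqI\<close>, this identifies the space with
  the square-summable sequences, so operators can be defined by prescribing coefficients.\<close>

lemma exists_hardy_coeff:
  assumes "summable (\<lambda>n. (cmod (c n))\<^sup>2)"
  shows "\<exists>f. hardy_coeff f = c"
proof -
  define F where "F = Abs_fps c"
  \<comment> \<open>The cut-off is forced by the type, whose members vanish off the disk.\<close>
  define f where "f z = (if z \<in> ball 0 1 then eval_fps F z else 0)" for z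
  have "(\<lambda>n. (cmod (c n))\<^sup>2) \<longlonglongrightarrow> 0"
    using assms by (rule summable_LIMSEQ_zero)
  then have "(\<lambda>n. sqrt ((cmod (c n))\<^sup>2)) \<longlonglongrightarrow> sqrt 0"
    by (rule tendsto_real_sqrt)
  then have "Bseq c"
    by (intro convergent_imp_Bseq) (auto simp: convergent_def tendsto_norm_zero_iff)
  then obtain K where K: "\<And>n. cmod (c n) \<le> K"
    by (auto simp: Bseq_def)
  have "summable (\<lambda>n. c n * z ^ n)" if "cmod z < 1" for z
  proof (rule summable_comparison_test'[where N = 0])
    show "summable (\<lambda>n. K * cmod z ^ n)"
      using that by (intro summable_mult summable_geometric) simp
    show "norm (c n * z ^ n) \<le> K * cmod z ^ n" for n
      using K[of n] by (simp add: norm_mult norm_power mult_right_mono)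
  qed
  then have radius: "fps_conv_radius F \<ge> 1"
    unfolding fps_conv_radius_def F_def
    by (intro conv_radius_geI_ex') (simp add: one_ereal_def)
  have "eval_fps F holomorphic_on ball 0 1"
  proof (rule holomorphic_on_eval_fps, rule subsetI)
    fix z :: complex
    assume "z \<in> ball 0 1"
    then have "ereal (cmod z) < 1"
      by (simp add: one_ereal_def)
    then have "ereal (cmod z) < fps_conv_radius F"
      using radius by (rule less_le_trans)
    then show "z \<in> eball 0 (fps_conv_radius F)"
      by simp
  qed
  then have hol: "f holomorphic_on ball 0 1"
    by (rule holomorphic_transform) (simp add: f_def)
  have "f has_fps_expansion F"
  proof -
    have "eval_fps F has_fps_expansion F"
      by (rule eval_fps_has_fps_expansion) (use radius in \<open>auto intro: less_le_trans[of 0 1]\<close>)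
    \<comment> \<open>The expansion depends only on values near 0, so the cut-off leaves it
      unchanged.\<close>
    moreover have "\<forall>\<^sub>F z in nhds 0. eval_fps F z = f z"
      using eventually_nhds_in_open[of "ball (0::complex) 1" 0]
      by (auto simp: f_def elim!: eventually_mono)
    ultimately show ?thesis
      by (simp add: has_fps_expansion_cong)
  qed
  then have exp: "fps_expansion f 0 = F"
    by (rule fps_expansion_eqI)
  have "hardy_fun (Abs_hardy f) = f"
    using hol assms by (intro Abs_hardy_inverse) (auto simp: exp F_def f_def)
  then have "hardy_coeff (Abs_hardy f) = c"
    by (auto simp: hardy_coeff_def exp F_def)
  then show ?thesis by blast
qed

text \<open>For square-summable \<open>c\<close> the choice is unique by \<open>hardy_eqI\<close>;
  for any other \<open>c\<close> no candidate exists and the value is arbitrary.\<close>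

definition hardy_of_coeff :: "(nat \<Rightarrow> complex) \<Rightarrow> hardy" where
  "hardy_of_coeff c = (SOME f. hardy_coeff f = c)"

lemma hardy_coeff_of_coeff:
  "summable (\<lambda>n. (cmod (c n))\<^sup>2) \<Longrightarrow> hardy_coeff (hardy_of_coeff c) = c"
  unfolding hardy_of_coeff_def by (rule someI_ex) (rule exists_hardy_coeff)

section \<open>Monomials and density of Taylor polynomials\<close>

definition hardy_monom :: "nat \<Rightarrow> hardy" where
  "hardy_monom n = hardy_of_coeff (\<lambda>m. of_bool (m = n))"

lemma hardy_coeff_monom: "hardy_coeff (hardy_monom n) m = of_bool (m = n)"
  unfolding hardy_monom_def
  by (subst hardy_coeff_of_coeff) (auto intro!: summable_finite[of "{n}"])

lemma hardy_cinner_monom_right: "hardy_cinner f (hardy_monom n) = hardy_coeff f n"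
  unfolding hardy_cinner_def hardy_coeff_monom
  by (subst suminf_finite[of "{n}"]) auto

lemma hardy_cinner_monom_left: "hardy_cinner (hardy_monom n) f = cnj (hardy_coeff f n)"
  by (metis hardy_cinner_commute hardy_cinner_monom_right)

lemma hardy_eq_cinnerI:
  assumes "\<And>h. hardy_cinner h f = hardy_cinner h g"
  shows "f = g"
  using assms[of "hardy_monom _"] by (intro hardy_eqI) (simp add: hardy_cinner_monom_left)

lemma hardy_cinner_polynomial:
  "hardy_cinner (\<Sum>i<N. hardy_scaleC (c i) (hardy_monom i)) g = (\<Sum>i<N. c i * cnj (hardy_coeff g i))"
  by (simp add: hardy_cinner_sum_left hardy_cinner_scaleC_left hardy_cinner_monom_left)

lemma hardy_coeff_polynomial:
  "hardy_coeff (\<Sum>i<N. hardy_scaleC (c i) (hardy_monom i)) n = (if n < N then c n else 0)"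
proof -
  have "(\<Sum>i<N. c i * of_bool (n = i)) = (\<Sum>i<N. if n = i then c i else 0)"
    by (rule sum.cong) auto
  then show ?thesis
    by (simp add: hardy_coeff_sum hardy_coeff_scaleC hardy_coeff_monom)
qed

lemma norm_hardy_polynomial_square:
  "(norm (\<Sum>i<N. hardy_scaleC (c i) (hardy_monom i)))\<^sup>2 = (\<Sum>i<N. (cmod (c i))\<^sup>2)"
  unfolding norm_hardy_square hardy_coeff_polynomial
  by (subst suminf_finite[of "{..<N}"]) auto

text \<open>The Taylor polynomial is an orthogonal projection of \<open>f\<close>, so by Pythagoras
  the squared error is the tail of the convergent series for the squared norm. Identities checked on
  monomials thus extend by continuity.\<close>

lemma hardy_taylor_tendsto:
  "(\<lambda>N. \<Sum>i<N. hardy_scaleC (hardy_coeff f i) (hardy_monom i)) \<longlonglongrightarrow> f"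
proof -
  let ?t = "\<lambda>N. \<Sum>i<N. hardy_scaleC (hardy_coeff f i) (hardy_monom i)"
  let ?s = "\<lambda>N. \<Sum>i<N. (cmod (hardy_coeff f i))\<^sup>2"
  have "(norm (?t N - f))\<^sup>2 = (norm f)\<^sup>2 - ?s N" for N
  proof -
    have "inner (?t N) f = ?s N"
      by (simp add: inner_hardy_def hardy_cinner_polynomial complex_norm_square[symmetric])
    moreover have "inner (?t N) (?t N) = ?s N"
      by (metis norm_hardy_polynomial_square power2_norm_eq_inner)
    ultimately show ?thesis
      by (simp add: power2_norm_eq_inner inner_diff_left inner_diff_right inner_commute)
  qed
  moreover have "(\<lambda>N. (norm f)\<^sup>2 - ?s N) \<longlonglongrightarrow> (norm f)\<^sup>2 - (norm f)\<^sup>2"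
    unfolding norm_hardy_square[of f]
    by (intro tendsto_diff tendsto_const summable_LIMSEQ summable_hardy_coeff)
  ultimately have "(\<lambda>N. sqrt ((norm (?t N - f))\<^sup>2)) \<longlonglongrightarrow> sqrt 0"
    by (intro tendsto_real_sqrt) simp
  then have "(\<lambda>N. ?t N - f) \<longlonglongrightarrow> 0"
    by (simp add: tendsto_norm_zero_iff)
  then show ?thesis
    by (rule LIM_zero_cancel)
qed

section \<open>Adjoints\<close>

lemma hardy_operators_scaleC:
  "X \<in> hardy_operators \<Longrightarrow> blinfun_apply X (hardy_scaleC c f) = hardy_scaleC c (blinfun_apply X f)"
  by (simp add: hardy_operators_def)

lemma hardy_operators_compose:
  "X \<in> hardy_operators \<Longrightarrow> Y \<in> hardy_operators \<Longrightarrow> X o\<^sub>L Y \<in> hardy_operators"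
  by (simp add: hardy_operators_def)

text \<open>The summands are the squared moduli of the coefficients that the adjoint must give
  \<open>g\<close>. For the polynomial \<open>t\<close> with these coefficients, \<open>Xt\<close>
  paired with \<open>g\<close> gives the squared norm of \<open>t\<close>; Cauchy-Schwarz and
  cancelling one factor \<open>norm t\<close> yield a bound independent of \<open>N\<close>.\<close>

lemma sum_cinner_operator_monom_le:
  assumes "X \<in> hardy_operators"
  shows "(\<Sum>n<N. (cmod (hardy_cinner g (blinfun_apply X (hardy_monom n))))\<^sup>2) \<le> (norm X * norm g)\<^sup>2"
    (is "?T \<le> _")
proof -
  define c where "c n = hardy_cinner g (blinfun_apply X (hardy_monom n))" for n
  define t where "t = (\<Sum>n<N. hardy_scaleC (c n) (hardy_monom n))"
  have T: "?T = (norm t)\<^sup>2"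
    by (simp add: t_def norm_hardy_polynomial_square c_def)
  have "hardy_cinner (blinfun_apply X t) g
      = (\<Sum>n<N. c n * hardy_cinner (blinfun_apply X (hardy_monom n)) g)"
    by (simp add: t_def blinfun.sum_right hardy_operators_scaleC[OF assms] hardy_cinner_sum_left
        hardy_cinner_scaleC_left)
  also have "\<dots> = (\<Sum>n<N. c n * cnj (c n))"
    unfolding c_def by (subst (2) hardy_cinner_commute) simp
  finally have "inner (blinfun_apply X t) g = (norm t)\<^sup>2"
    unfolding T[symmetric] by (simp add: inner_hardy_def c_def complex_norm_square[symmetric])
  then have "(norm t)\<^sup>2 \<le> norm (blinfun_apply X t) * norm g"
    using norm_cauchy_schwarz[of "blinfun_apply X t" g] by simp
  also have "\<dots> \<le> norm X * norm t * norm g"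
    by (intro mult_right_mono norm_blinfun) simp
  finally have "norm t * norm t \<le> (norm X * norm g) * norm t"
    by (simp add: power2_eq_square mult_ac)
  then have "norm t \<le> norm X * norm g"
    by (cases "norm t = 0") (auto simp: mult_le_cancel_right)
  then show ?thesis
    unfolding T by (rule power_mono) simp
qed

text \<open>The uniform bound on partial sums gives both square-summability of the prescribed
  coefficients and boundedness of the resulting map.\<close>

lemma exists_hardy_adjoint:
  assumes "X \<in> hardy_operators"
  shows "\<exists>Y\<in>hardy_operators.
    \<forall>f g. hardy_cinner (blinfun_apply X f) g = hardy_cinner f (blinfun_apply Y g)"
proof -
  \<comment> \<open>Pairing the adjoint's value at \<open>g\<close> with the n-th monomial must give
    \<open>g\<close> paired with \<open>X\<close> of that monomial, which determines every
    coefficient.\<close>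
  define y where "y g = hardy_of_coeff (\<lambda>n. hardy_cinner g (blinfun_apply X (hardy_monom n)))" for g
  have summable: "summable (\<lambda>n. (cmod (hardy_cinner g (blinfun_apply X (hardy_monom n))))\<^sup>2)" for g
    by (rule summableI_nonneg_bounded[OF _ sum_cinner_operator_monom_le[OF assms]]) simp
  have coeff: "hardy_coeff (y g) n = hardy_cinner g (blinfun_apply X (hardy_monom n))" for g n
    by (simp add: y_def hardy_coeff_of_coeff[OF summable])
  have scaleC: "y (hardy_scaleC c g) = hardy_scaleC c (y g)" for c g
    by (rule hardy_eqI) (simp add: coeff hardy_coeff_scaleC hardy_cinner_scaleC_left)
  have "bounded_linear y"
  proof (rule bounded_linear_intro[where K = "norm X"])
    show "y (f + g) = y f + y g" for f g
      by (rule hardy_eqI) (simp add: coeff hardy_coeff_add hardy_cinner_add_left)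
    show "y (r *\<^sub>R f) = r *\<^sub>R y f" for r f
      by (simp add: scaleR_hardy_def scaleC)
    fix g
    have "(norm (y g))\<^sup>2 \<le> (norm X * norm g)\<^sup>2"
      unfolding norm_hardy_square coeff
      by (intro suminf_le_const summable sum_cinner_operator_monom_le assms)
    then show "norm (y g) \<le> norm g * norm X"
      by (simp add: power2_le_iff_abs_le abs_mult mult.commute)
  qed
  then have apply_y: "blinfun_apply (Blinfun y) = y"
    by (rule bounded_linear_Blinfun_apply)
  \<comment> \<open>The limit is taken in the real inner product, whose continuity comes from its
    type class.\<close>
  have inner: "inner (blinfun_apply X f) g = inner f (y g)" for f g
  proof -
    let ?t = "\<lambda>N. \<Sum>i<N. hardy_scaleC (hardy_coeff f i) (hardy_monom i)"
    have "inner (blinfun_apply X (?t N)) g = inner (?t N) (y g)" for N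
      by (simp add: inner_hardy_def hardy_cinner_monom_left coeff blinfun.sum_right
          hardy_operators_scaleC[OF assms] hardy_cinner_sum_left hardy_cinner_scaleC_left
          hardy_cinner_commute[symmetric])
    moreover have "(\<lambda>N. inner (blinfun_apply X (?t N)) g) \<longlonglongrightarrow> inner (blinfun_apply X f) g"
      by (intro tendsto_intros hardy_taylor_tendsto)
    moreover have "(\<lambda>N. inner (?t N) (y g)) \<longlonglongrightarrow> inner f (y g)"
      by (intro tendsto_intros hardy_taylor_tendsto)
    ultimately show ?thesis
      by (intro LIMSEQ_unique) simp_all
  qed
  \<comment> \<open>Replacing \<open>f\<close> by \<open>\<i> f\<close> turns real parts into
    negated imaginary parts, so the real identity implies the complex one.\<close>
  have "hardy_cinner (blinfun_apply X f) g = hardy_cinner f (y g)" for f g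
    using inner[of f g] inner[of "hardy_scaleC \<i> f" g]
    by (simp add: inner_hardy_def hardy_operators_scaleC[OF assms] hardy_cinner_scaleC_left
        complex_eq_iff)
  then show ?thesis
    using scaleC by (intro bexI[of _ "Blinfun y"]) (auto simp: apply_y hardy_operators_def)
qed

text \<open>Pairing with all vectors separates points, so the definite description in
  \<open>hardy_adjoint\<close> has at most one candidate.\<close>

lemma hardy_adjoint_eqI:
  assumes "Y \<in> hardy_operators"
    and "\<And>f g. hardy_cinner (blinfun_apply X f) g = hardy_cinner f (blinfun_apply Y g)"
  shows "hardy_adjoint X = Y"
  unfolding hardy_adjoint_def
proof (rule the_equality)
  fix Z
  assume "Z \<in> hardy_operators \<and>
    (\<forall>f g. hardy_cinner (blinfun_apply X f) g = hardy_cinner f (blinfun_apply Z g))"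
  then show "Z = Y"
    using assms(2) by (intro blinfun_eqI hardy_eq_cinnerI) simp
qed (use assms in blast)

lemma
  assumes "X \<in> hardy_operators"
  shows hardy_adjoint_in_operators: "hardy_adjoint X \<in> hardy_operators"
    and hardy_cinner_adjoint_right:
      "hardy_cinner f (blinfun_apply (hardy_adjoint X) g) = hardy_cinner (blinfun_apply X f) g"
proof -
  obtain Y where Y: "Y \<in> hardy_operators"
    "\<And>f g. hardy_cinner (blinfun_apply X f) g = hardy_cinner f (blinfun_apply Y g)"
    using exists_hardy_adjoint[OF assms] by blast
  with hardy_adjoint_eqI[OF Y]
  show "hardy_adjoint X \<in> hardy_operators"
    "hardy_cinner f (blinfun_apply (hardy_adjoint X) g) = hardy_cinner (blinfun_apply X f) g"
    by simp_all
qed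

lemma hardy_cinner_adjoint_left:
  assumes "X \<in> hardy_operators"
  shows "hardy_cinner (blinfun_apply (hardy_adjoint X) f) g = hardy_cinner f (blinfun_apply X g)"
  by (metis assms hardy_cinner_adjoint_right hardy_cinner_commute)

lemma hardy_adjoint_compose:
  assumes "X \<in> hardy_operators" "Y \<in> hardy_operators"
  shows "hardy_adjoint (X o\<^sub>L Y) = hardy_adjoint Y o\<^sub>L hardy_adjoint X"
  using assms
  by (intro hardy_adjoint_eqI hardy_operators_compose hardy_adjoint_in_operators)
    (simp_all add: hardy_cinner_adjoint_right)

lemma hardy_adjoint_adjoint: "X \<in> hardy_operators \<Longrightarrow> hardy_adjoint (hardy_adjoint X) = X"
  by (rule hardy_adjoint_eqI) (simp_all add: hardy_cinner_adjoint_left)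

text \<open>Complex linearity makes \<open>X\<close> vanish on all complex polynomials, and these
  are dense; real linearity would only reach real coefficients.\<close>

lemma hardy_operator_eq_zeroI:
  assumes "X \<in> hardy_operators" "\<And>n. blinfun_apply X (hardy_monom n) = 0"
  shows "X = 0"
proof (rule blinfun_eqI)
  fix f
  have "(\<lambda>N. blinfun_apply X (\<Sum>i<N. hardy_scaleC (hardy_coeff f i) (hardy_monom i)))
      \<longlonglongrightarrow> blinfun_apply X f"
    by (intro tendsto_intros hardy_taylor_tendsto)
  then have "(\<lambda>N. 0) \<longlonglongrightarrow> blinfun_apply X f"
    by (simp add: blinfun.sum_right hardy_operators_scaleC[OF assms(1)] assms(2)
        hardy_scaleC_zero)
  then show "blinfun_apply X f = blinfun_apply 0 f"
    by (simp add: LIMSEQ_const_iff)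
qed

section \<open>The shift and its adjoint\<close>

lemma hardy_coeff_shift:
  "hardy_coeff (blinfun_apply hardy_shift f) n = (if n = 0 then 0 else hardy_coeff f (n - 1))"
  by (simp add: hardy_shift.rep_eq hardy_coeff_mult_z)

lemma hardy_shift_in_operators: "hardy_shift \<in> hardy_operators"
  unfolding hardy_operators_def
  by (auto intro!: hardy_eqI simp: hardy_coeff_shift hardy_coeff_scaleC)

lemma hardy_shift_monom: "blinfun_apply hardy_shift (hardy_monom n) = hardy_monom (Suc n)"
  by (rule hardy_eqI) (auto simp: hardy_coeff_shift hardy_coeff_monom)

text \<open>The adjoint is the backward shift: its n-th coefficient is a pairing with the n-th
  monomial, and moving the shift across turns that monomial into the next one.\<close>

lemma hardy_coeff_adjoint_shift:
  "hardy_coeff (blinfun_apply (hardy_adjoint hardy_shift) f) n = hardy_coeff f (Suc n)"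
  by (metis hardy_cinner_adjoint_left hardy_cinner_monom_right hardy_shift_in_operators
      hardy_shift_monom)

lemma hardy_adjoint_shift_shift:
  "blinfun_apply (hardy_adjoint hardy_shift) (blinfun_apply hardy_shift f) = f"
  by (rule hardy_eqI) (simp add: hardy_coeff_adjoint_shift hardy_coeff_shift)

lemma hardy_shift_eq_zero_iff: "blinfun_apply hardy_shift f = 0 \<longleftrightarrow> f = 0"
  by (metis blinfun.zero_right hardy_adjoint_shift_shift)

lemma hardy_adjoint_shift_monom_0: "blinfun_apply (hardy_adjoint hardy_shift) (hardy_monom 0) = 0"
  by (rule hardy_eqI) (simp add: hardy_coeff_adjoint_shift hardy_coeff_monom hardy_coeff_zero)

lemma hardy_adjoint_shift_monom_Suc:
  "blinfun_apply (hardy_adjoint hardy_shift) (hardy_monom (Suc n)) = hardy_monom n"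
  by (metis hardy_adjoint_shift_shift hardy_shift_monom)

lemma hardy_shift_adjoint_shift_decomp:
  "f = blinfun_apply hardy_shift (blinfun_apply (hardy_adjoint hardy_shift) f)
     + hardy_scaleC (hardy_coeff f 0) (hardy_monom 0)"
  by (rule hardy_eqI)
    (simp add: hardy_coeff_add hardy_coeff_shift hardy_coeff_adjoint_shift hardy_coeff_scaleC
      hardy_coeff_monom)

section \<open>The two operator equations\<close>

lemma shift_intertwines_adjoint_imp_zero:
  assumes X: "X \<in> hardy_operators"
    and eq: "hardy_shift o\<^sub>L X = X o\<^sub>L hardy_adjoint hardy_shift"
  shows "X = 0"
proof (rule hardy_operator_eq_zeroI[OF X])
  have apply_eq: "blinfun_apply hardy_shift (blinfun_apply X f)
      = blinfun_apply X (blinfun_apply (hardy_adjoint hardy_shift) f)" for f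
    using arg_cong[OF eq, of "\<lambda>Z. blinfun_apply Z f"] by simp
  show "blinfun_apply X (hardy_monom n) = 0" for n
  proof (induction n)
    case 0
    show ?case
      using apply_eq[of "hardy_monom 0"]
      by (simp add: hardy_adjoint_shift_monom_0 hardy_shift_eq_zero_iff blinfun.zero_right)
  next
    case (Suc n)
    then show ?case
      using apply_eq[of "hardy_monom (Suc n)"]
      by (simp add: hardy_adjoint_shift_monom_Suc hardy_shift_eq_zero_iff)
  qed
qed

lemma shift_intertwines_adjoints_imp_factor:
  assumes X: "X \<in> hardy_operators"
    and eq: "hardy_shift o\<^sub>L X = hardy_adjoint X o\<^sub>L hardy_adjoint hardy_shift"
  shows "hardy_selfadjoint (X o\<^sub>L hardy_shift)"
    and "X = (X o\<^sub>L hardy_shift) o\<^sub>L hardy_adjoint hardy_shift"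
proof -
  have apply_eq: "blinfun_apply hardy_shift (blinfun_apply X f)
      = blinfun_apply (hardy_adjoint X) (blinfun_apply (hardy_adjoint hardy_shift) f)" for f
    using arg_cong[OF eq, of "\<lambda>Z. blinfun_apply Z f"] by simp
  \<comment> \<open>Evaluating the equation at \<open>Sf\<close> and then applying the backward
    shift cancels one shift on each side. The left-hand side is the adjoint of \<open>XS\<close> at
    \<open>f\<close>.\<close>
  have "blinfun_apply (hardy_adjoint hardy_shift) (blinfun_apply (hardy_adjoint X) f)
      = blinfun_apply X (blinfun_apply hardy_shift f)" for f
    using apply_eq[of "blinfun_apply hardy_shift f", symmetric]
    by (simp add: hardy_adjoint_shift_shift)
  then have "hardy_adjoint hardy_shift o\<^sub>L hardy_adjoint X = X o\<^sub>L hardy_shift"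
    by (intro blinfun_eqI) simp
  then show "hardy_selfadjoint (X o\<^sub>L hardy_shift)"
    by (simp add: hardy_selfadjoint_def hardy_adjoint_compose X hardy_shift_in_operators)
  have kill: "blinfun_apply X (hardy_monom 0) = 0"
    using apply_eq[of "hardy_monom 0"]
    by (simp add: hardy_adjoint_shift_monom_0 hardy_shift_eq_zero_iff blinfun.zero_right)
  have "blinfun_apply X f
      = blinfun_apply X (blinfun_apply hardy_shift (blinfun_apply (hardy_adjoint hardy_shift) f))"
    for f
    using arg_cong[OF hardy_shift_adjoint_shift_decomp[of f], of "blinfun_apply X"]
    by (simp add: blinfun.add_right hardy_operators_scaleC[OF X] kill hardy_scaleC_zero)
  then show "X = (X o\<^sub>L hardy_shift) o\<^sub>L hardy_adjoint hardy_shift"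
    by (intro blinfun_eqI) simp
qed

text \<open>Taking adjoints reverses the factors of \<open>X\<close> and gives \<open>SA\<close>, so
  both sides of the equation are \<open>S\<close> times \<open>A\<close> times the backward
  shift.\<close>

lemma selfadjoint_compose_adjoint_shift_intertwines:
  assumes A: "A \<in> hardy_operators" "hardy_selfadjoint A"
    and X: "X = A o\<^sub>L hardy_adjoint hardy_shift"
  shows "hardy_shift o\<^sub>L X = hardy_adjoint X o\<^sub>L hardy_adjoint hardy_shift"
proof -
  have "hardy_adjoint X = hardy_shift o\<^sub>L A"
    using A by (simp add: X hardy_adjoint_compose hardy_adjoint_in_operators hardy_adjoint_adjoint
        hardy_shift_in_operators hardy_selfadjoint_def)
  then show ?thesis
    by (intro blinfun_eqI) (simp add: X)
qed

theorem theorem3p1: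
  fixes X :: "hardy \<Rightarrow>\<^sub>L hardy"
  assumes "X \<in> hardy_operators"
  shows "(hardy_shift o\<^sub>L X = X o\<^sub>L hardy_adjoint hardy_shift \<longleftrightarrow> X = 0) \<and>
    (hardy_shift o\<^sub>L X = hardy_adjoint X o\<^sub>L hardy_adjoint hardy_shift \<longleftrightarrow>
       (\<exists>A\<in>hardy_operators. hardy_selfadjoint A \<and> X = A o\<^sub>L hardy_adjoint hardy_shift))"
proof (intro conjI iffI)
  show "X = 0" if "hardy_shift o\<^sub>L X = X o\<^sub>L hardy_adjoint hardy_shift"
    using assms that by (rule shift_intertwines_adjoint_imp_zero)
  show "hardy_shift o\<^sub>L X = X o\<^sub>L hardy_adjoint hardy_shift" if "X = 0"
    using that by (intro blinfun_eqI) (simp add: blinfun.zero_right)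
  show "\<exists>A\<in>hardy_operators. hardy_selfadjoint A \<and> X = A o\<^sub>L hardy_adjoint hardy_shift"
    if "hardy_shift o\<^sub>L X = hardy_adjoint X o\<^sub>L hardy_adjoint hardy_shift"
    \<comment> \<open>The witness is \<open>A = XS\<close>.\<close>
    using shift_intertwines_adjoints_imp_factor[OF assms that] assms
    by (blast intro: hardy_operators_compose hardy_shift_in_operators)
  show "hardy_shift o\<^sub>L X = hardy_adjoint X o\<^sub>L hardy_adjoint hardy_shift"
    if "\<exists>A\<in>hardy_operators. hardy_selfadjoint A \<and> X = A o\<^sub>L hardy_adjoint hardy_shift"
    using that selfadjoint_compose_adjoint_shift_intertwines by blast
qed

end
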